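(* Let $\mathcal{G}$ be a hereditary class of graphs that has only finitely many forbidden induced subgraphs. Then the edge-apex class $\mathcal{G}^{e}$ of $\mathcal{G}$ is hereditary and has only finitely many forbidden induced subgraphs.
   Context: All graphs are finite, simple and undirected. A class of graphs is hereditary if it is closed under taking induced subgraphs (and isomorphism). For a hereditary class $\mathcal{G}$, a forbidden induced subgraph for $\mathcal{G}$ is a graph $H$ not in $\mathcal{G}$ such that every proper induced subgraph of $H$ is in $\mathcal{G}$. The edge-apex class $\mathcal{G}^{e}$ of $\mathcal{G}$ is the class of graphs $G$ such that either $G\in\mathcal{G}$ or $G$ has an edge $e$ with $G-e\in\mathcal{G}$, where $G-e$ denotes deletion of the edge $e$ (keeping all vertices). *)

theory Defs
  imports Main
begin

record 'a graph =
  verts :: "'a set"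
  edges :: "'a set set"

definition simple_graph :: "'a graph \<Rightarrow> bool" where
  "simple_graph G \<longleftrightarrow> finite (verts G) \<and> (\<forall>e\<in>edges G. e \<subseteq> verts G \<and> card e = 2)"

definition graph_iso :: "'a graph \<Rightarrow> 'a graph \<Rightarrow> bool" where
  "graph_iso G H \<longleftrightarrow> (\<exists>f. bij_betw f (verts G) (verts H) \<and>
     (\<forall>u\<in>verts G. \<forall>v\<in>verts G. {u, v} \<in> edges G \<longleftrightarrow> {f u, f v} \<in> edges H))"

definition induced :: "'a graph \<Rightarrow> 'a set \<Rightarrow> 'a graph" where
  "induced G S = \<lparr>verts = S, edges = {e \<in> edges G. e \<subseteq> S}\<rparr>"

definition delete_edge :: "'a graph \<Rightarrow> 'a set \<Rightarrow> 'a graph" where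
  "delete_edge G e = \<lparr>verts = verts G, edges = edges G - {e}\<rparr>"

text \<open>
  A class of graphs is a set of simple graphs over a type \<open>'a\<close> of potential vertices.
  For infinite \<open>'a\<close> (such as \<open>nat\<close>) every finite graph has an isomorphic copy over
  \<open>'a\<close>, so that isomorphism-closed classes of finite graphs are the same thing as
  isomorphism-closed sets of graphs over \<open>'a\<close>.
\<close>

definition hereditary :: "'a graph set \<Rightarrow> bool" where
  "hereditary \<G> \<longleftrightarrow>
     (\<forall>G\<in>\<G>. simple_graph G) \<and>
     (\<forall>G\<in>\<G>. \<forall>H. simple_graph H \<and> graph_iso G H \<longrightarrow> H \<in> \<G>) \<and>
     (\<forall>G\<in>\<G>. \<forall>S. S \<subseteq> verts G \<longrightarrow> induced G S \<in> \<G>)"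

definition forbidden_induced_subgraphs :: "'a graph set \<Rightarrow> 'a graph set" where
  "forbidden_induced_subgraphs \<G> =
     {H. simple_graph H \<and> H \<notin> \<G> \<and> (\<forall>S. S \<subset> verts H \<longrightarrow> induced H S \<in> \<G>)}"

text \<open>Finiteness is counted up to isomorphism: finitely many representatives suffice.\<close>

definition finite_up_to_iso :: "'a graph set \<Rightarrow> bool" where
  "finite_up_to_iso \<F> \<longleftrightarrow> (\<exists>R. finite R \<and> R \<subseteq> \<F> \<and> (\<forall>H\<in>\<F>. \<exists>K\<in>R. graph_iso H K))"

definition edge_apex :: "'a graph set \<Rightarrow> 'a graph set" where
  "edge_apex \<G> =
     {G. simple_graph G \<and> (G \<in> \<G> \<or> (\<exists>e\<in>edges G. delete_edge G e \<in> \<G>))}"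

end

(* Membership in a hereditary class with finitely many forbidden induced subgraphs is
   local: there is a constant c such that every graph outside the class has at most c
   vertices that already induce a graph outside the class.  Let H be forbidden for the
   edge-apex class, and choose such a set S for H and, for each edge e inside S, such a
   set P e for H - e.  Deleting an edge that is not inside S does not affect H[S], so the
   union of S and all the sets P e already induces a graph outside the edge-apex class.
   By minimality this union is the whole vertex set, which bounds the order of H. *)

theory Submission
  imports Defs
begin

section \<open>Induced subgraphs, edge deletion and isomorphism\<close>

lemma simple_graph_induced:
  "simple_graph G \<Longrightarrow> S \<subseteq> verts G \<Longrightarrow> simple_graph (induced G S)"
  by (auto simp: simple_graph_def induced_def finite_subset)

lemma simple_graph_delete_edge: "simple_graph G \<Longrightarrow> simple_graph (delete_edge G e)"
  by (auto simp: simple_graph_def delete_edge_def)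

lemma verts_induced [simp]: "verts (induced G S) = S"
  by (simp add: induced_def)

lemma verts_delete_edge [simp]: "verts (delete_edge G e) = verts G"
  by (simp add: delete_edge_def)

lemma edges_induced [simp]: "edges (induced G S) = {e \<in> edges G. e \<subseteq> S}"
  by (simp add: induced_def)

lemma edges_delete_edge [simp]: "edges (delete_edge G e) = edges G - {e}"
  by (simp add: delete_edge_def)

lemma induced_induced: "S \<subseteq> T \<Longrightarrow> induced (induced G T) S = induced G S"
  by (auto simp: induced_def)

lemma induced_delete_edge: "induced (delete_edge G e) S = delete_edge (induced G S) e"
  by (auto simp: induced_def delete_edge_def)

lemma delete_non_edge: "e \<notin> edges G \<Longrightarrow> delete_edge G e = G"
  by (simp add: delete_edge_def)

lemma hereditary_iso:
  "hereditary \<G> \<Longrightarrow> G \<in> \<G> \<Longrightarrow> simple_graph H \<Longrightarrow> graph_iso G H \<Longrightarrow> H \<in> \<G>"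
  unfolding hereditary_def by blast

lemma hereditary_induced: "hereditary \<G> \<Longrightarrow> G \<in> \<G> \<Longrightarrow> S \<subseteq> verts G \<Longrightarrow> induced G S \<in> \<G>"
  unfolding hereditary_def by blast

lemma graph_iso_card: "graph_iso G H \<Longrightarrow> card (verts G) = card (verts H)"
  by (auto simp: graph_iso_def bij_betw_same_card)

section \<open>Heredity of the edge-apex class\<close>

lemma graph_iso_delete_edge:
  assumes "simple_graph G" "graph_iso G H" "e \<in> edges G"
  obtains e' where "e' \<in> edges H" "graph_iso (delete_edge G e) (delete_edge H e')"
proof -
  obtain f where f: "bij_betw f (verts G) (verts H)"
    and fE: "\<And>u v. u \<in> verts G \<Longrightarrow> v \<in> verts G \<Longrightarrow> {u, v} \<in> edges G \<longleftrightarrow> {f u, f v} \<in> edges H"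
    using assms(2) by (auto simp: graph_iso_def)
  have e: "e \<subseteq> verts G" "card e = 2"
    using assms(1,3) by (auto simp: simple_graph_def)
  then obtain a b where ab: "e = {a, b}"
    by (auto simp: card_2_iff)
  have "f ` e \<in> edges H"
    using fE[of a b] ab e assms(3) by simp
  \<comment> \<open>Injectivity of \<open>f\<close> on vertices makes \<open>e\<close> the only
    vertex pair mapped onto its image, so removing \<open>e\<close> on one side and its image on the
    other keeps \<open>f\<close> an isomorphism.\<close>
  moreover have "{f u, f v} = f ` e \<longleftrightarrow> {u, v} = e" if "u \<in> verts G" "v \<in> verts G" for u v
    using inj_on_image_eq_iff[OF bij_betw_imp_inj_on[OF f], of "{u, v}" e] that e by simp
  then have "graph_iso (delete_edge G e) (delete_edge H (f ` e))"
    using f fE by (auto simp: graph_iso_def intro!: exI[of _ f])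
  ultimately show ?thesis
    using that by blast
qed

lemma hereditary_edge_apex:
  assumes "hereditary \<G>"
  shows "hereditary (edge_apex \<G>)"
  unfolding hereditary_def
proof (intro conjI ballI allI impI)
  fix G assume G: "G \<in> edge_apex \<G>"
  then show sG: "simple_graph G"
    by (simp add: edge_apex_def)
  {
    fix H assume H: "simple_graph H \<and> graph_iso G H"
    show "H \<in> edge_apex \<G>"
    proof (cases "G \<in> \<G>")
      case True
      then show ?thesis
        using H hereditary_iso[OF assms] by (auto simp: edge_apex_def)
    next
      case False
      then obtain e where e: "e \<in> edges G" "delete_edge G e \<in> \<G>"
        using G by (auto simp: edge_apex_def)
      obtain e' where e': "e' \<in> edges H" "graph_iso (delete_edge G e) (delete_edge H e')"
        using graph_iso_delete_edge[OF sG _ e(1)] H by blast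
      have "delete_edge H e' \<in> \<G>"
        using hereditary_iso[OF assms e(2) _ e'(2)] H simple_graph_delete_edge by blast
      then show ?thesis
        using H e'(1) by (auto simp: edge_apex_def)
    qed
  next
    fix S assume S: "S \<subseteq> verts G"
    show "induced G S \<in> edge_apex \<G>"
    proof (cases "G \<in> \<G>")
      case True
      then show ?thesis
        using hereditary_induced[OF assms True S] simple_graph_induced[OF sG S]
        by (simp add: edge_apex_def)
    next
      case False
      then obtain e where e: "e \<in> edges G" "delete_edge G e \<in> \<G>"
        using G by (auto simp: edge_apex_def)
      have "delete_edge (induced G S) e \<in> \<G>"
        using hereditary_induced[OF assms e(2), of S] S by (simp add: induced_delete_edge)
      \<comment> \<open>The edge \<open>e\<close> need not lie inside \<open>S\<close>; if it does
        not, deleting it changes nothing and the first alternative holds.\<close>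
      then have "induced G S \<in> \<G> \<or> (\<exists>e\<in>edges (induced G S). delete_edge (induced G S) e \<in> \<G>)"
        using delete_non_edge by metis
      then show ?thesis
        using simple_graph_induced[OF sG S] by (simp add: edge_apex_def)
    qed
  }
qed

section \<open>Finiteness up to isomorphism as a bound on the order\<close>

lemma finite_up_to_iso_imp_bounded:
  assumes "finite_up_to_iso \<F>"
  obtains c where "\<And>H. H \<in> \<F> \<Longrightarrow> card (verts H) \<le> c"
proof -
  obtain R where R: "finite R" "\<forall>H\<in>\<F>. \<exists>K\<in>R. graph_iso H K"
    using assms by (auto simp: finite_up_to_iso_def)
  \<comment> \<open>\<open>Max\<close> is unspecified when \<open>R\<close> is empty, but then
    \<open>\<F>\<close> is empty too and the claim is vacuous.\<close>
  have "card (verts H) \<le> Max ((\<lambda>K. card (verts K)) ` R)" if H: "H \<in> \<F>" for H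
  proof -
    obtain K where "K \<in> R" "graph_iso H K"
      using R(2) H by blast
    then show ?thesis
      using R(1) by (simp add: graph_iso_card)
  qed
  then show ?thesis
    by (rule that)
qed

text \<open>Relabelling vertices by an initial segment of the naturals gives each graph a code.
  Equal codes force isomorphism, and a bound on the order leaves only finitely many codes.\<close>

lemma bounded_imp_finite_up_to_iso:
  assumes simple: "\<And>H. H \<in> \<F> \<Longrightarrow> simple_graph H"
    and bound: "\<And>H. H \<in> \<F> \<Longrightarrow> card (verts H) \<le> c"
  shows "finite_up_to_iso \<F>"
proof -
  have "\<exists>f. bij_betw f (verts H) {0..<card (verts H)}" if "H \<in> \<F>" for H
    using ex_bij_betw_finite_nat simple[OF that] by (auto simp: simple_graph_def)
  then obtain lab where lab: "\<And>H. H \<in> \<F> \<Longrightarrow> bij_betw (lab H) (verts H) {0..<card (verts H)}"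
    by metis
  \<comment> \<open>The order is recorded as well, since isolated vertices leave no trace in the
    edge set.\<close>
  define code where "code H = (card (verts H), (`) (lab H) ` edges H)" for H
  have edge_iff: "lab H ` X \<in> snd (code H) \<longleftrightarrow> X \<in> edges H" if "H \<in> \<F>" "X \<subseteq> verts H" for H X
  proof -
    have "inj_on ((`) (lab H)) (Pow (verts H))"
      using lab[OF that(1)] by (simp add: bij_betw_def inj_on_image_Pow)
    moreover have "edges H \<subseteq> Pow (verts H)"
      using simple[OF that(1)] by (auto simp: simple_graph_def)
    ultimately show ?thesis
      using that(2) by (simp add: code_def inj_on_image_mem_iff)
  qed
  have iso: "graph_iso H K" if HK: "H \<in> \<F>" "K \<in> \<F>" and eq: "code H = code K" for H K
  proof -
    have card_eq: "card (verts H) = card (verts K)"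
      using eq by (simp add: code_def)
    \<comment> \<open>Both labellings use the same range because the orders agree, so a vertex of
      \<open>H\<close> is sent to the vertex of \<open>K\<close> with the same label.\<close>
    define g where "g = inv_into (verts K) (lab K) \<circ> lab H"
    have g: "bij_betw g (verts H) (verts K)"
      unfolding g_def using lab[OF HK(1)] bij_betw_inv_into[OF lab[OF HK(2)]] card_eq
      by (auto intro: bij_betw_trans)
    have lab_g: "lab K (g u) = lab H u" if "u \<in> verts H" for u
      using bij_betw_inv_into_right[OF lab[OF HK(2)]] bij_betwE[OF lab[OF HK(1)]] that card_eq
      by (simp add: g_def)
    have "{u, v} \<in> edges H \<longleftrightarrow> {g u, g v} \<in> edges K" if "u \<in> verts H" "v \<in> verts H" for u v
      using edge_iff[OF HK(1), of "{u, v}"] edge_iff[OF HK(2), of "{g u, g v}"]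
        lab_g that bij_betwE[OF g] eq by simp
    then show ?thesis
      using g by (auto simp: graph_iso_def)
  qed
  \<comment> \<open>Labels stay below the order of the graph, hence below \<open>c\<close>.\<close>
  have "code ` \<F> \<subseteq> {..c} \<times> Pow (Pow {..<c})"
  proof
    fix x assume "x \<in> code ` \<F>"
    then obtain H where H: "H \<in> \<F>" "x = code H"
      by blast
    have "lab H ` e \<subseteq> {..<c}" if "e \<in> edges H" for e
    proof -
      have "e \<subseteq> verts H"
        using simple[OF H(1)] that by (auto simp: simple_graph_def)
      then show ?thesis
        using bij_betwE[OF lab[OF H(1)]] bound[OF H(1)] by force
    qed
    then show "x \<in> {..c} \<times> Pow (Pow {..<c})"
      using H bound by (auto simp: code_def)
  qed
  then have fin: "finite (code ` \<F>)"
    by (rule finite_subset) simp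
  \<comment> \<open>One representative is chosen for each code that occurs.\<close>
  define R where "R = inv_into \<F> code ` code ` \<F>"
  have "finite R"
    using fin by (simp add: R_def)
  moreover have "R \<subseteq> \<F>"
    by (auto simp: R_def inv_into_into)
  moreover have "\<exists>K\<in>R. graph_iso H K" if H: "H \<in> \<F>" for H
  proof
    show "inv_into \<F> code (code H) \<in> R"
      using H by (simp add: R_def)
    show "graph_iso H (inv_into \<F> code (code H))"
      using H by (intro iso) (auto simp: inv_into_into f_inv_into_f)
  qed
  ultimately show ?thesis
    by (auto simp: finite_up_to_iso_def)
qed

section \<open>Bounding the order of forbidden graphs\<close>

lemma ex_induced_forbidden:
  assumes "simple_graph G" "G \<notin> \<G>"
  obtains S where "S \<subseteq> verts G" "induced G S \<in> forbidden_induced_subgraphs \<G>"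
proof -
  have "induced G (verts G) = G"
    using assms(1) by (auto simp: induced_def simple_graph_def intro!: graph.equality)
  \<comment> \<open>The vertex sets inducing graphs outside \<open>\<G>\<close> form a finite
    family, nonempty because of \<open>verts G\<close>. An inclusion-minimal member induces a
    forbidden graph.\<close>
  then have "verts G \<in> {S. S \<subseteq> verts G \<and> induced G S \<notin> \<G>}" (is "_ \<in> ?A")
    using assms(2) by simp
  then have "?A \<noteq> {}"
    by (metis empty_iff)
  moreover have "finite ?A"
    using assms(1) by (simp add: simple_graph_def)
  ultimately have "\<exists>S\<in>?A. \<forall>T\<in>?A. T \<subseteq> S \<longrightarrow> S = T"
    by (intro finite_has_minimal)
  then obtain S where S: "S \<subseteq> verts G" "induced G S \<notin> \<G>"
    and S_min: "\<And>T. T \<subseteq> verts G \<Longrightarrow> induced G T \<notin> \<G> \<Longrightarrow> T \<subseteq> S \<Longrightarrow> S = T"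
    by auto
  have "induced (induced G S) T \<in> \<G>" if T: "T \<subset> S" for T
    using S_min[of T] S(1) T by (auto simp: induced_induced)
  then have "induced G S \<in> forbidden_induced_subgraphs \<G>"
    using S simple_graph_induced[OF assms(1), of S]
    by (simp add: forbidden_induced_subgraphs_def)
  then show ?thesis
    using that S by blast
qed

text \<open>The summand \<open>c\<close> pays for \<open>S\<close>. The edges inside
  \<open>S\<close> are counted crudely as subsets of \<open>S\<close>, so there are at most
  \<open>2 ^ c\<close> of them, and each contributes a set \<open>P e\<close> of at most
  \<open>c\<close> vertices.\<close>

lemma card_forbidden_edge_apex_le:
  assumes her: "hereditary \<G>"
    and c: "\<And>H. H \<in> forbidden_induced_subgraphs \<G> \<Longrightarrow> card (verts H) \<le> c"
    and H: "H \<in> forbidden_induced_subgraphs (edge_apex \<G>)"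
  shows "card (verts H) \<le> c + 2 ^ c * c"
proof -
  have sH: "simple_graph H" and H_notin: "H \<notin> edge_apex \<G>"
    and H_min: "\<And>S. S \<subset> verts H \<Longrightarrow> induced H S \<in> edge_apex \<G>"
    using H by (auto simp: forbidden_induced_subgraphs_def)
  have local: "\<exists>S \<subseteq> verts G. card S \<le> c \<and> induced G S \<notin> \<G>"
    if G: "simple_graph G" "G \<notin> \<G>" for G
  proof -
    obtain S where "S \<subseteq> verts G" "induced G S \<in> forbidden_induced_subgraphs \<G>"
      using ex_induced_forbidden[OF G] .
    then show ?thesis
      using c[of "induced G S"] by (auto simp: forbidden_induced_subgraphs_def)
  qed
  obtain S where S: "S \<subseteq> verts H" "card S \<le> c" "induced H S \<notin> \<G>"
    using local[of H] sH H_notin by (auto simp: edge_apex_def)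
  define E where "E = edges (induced H S)"
  \<comment> \<open>Each \<open>e\<close> in \<open>E\<close> is an edge of \<open>H\<close>, so
    \<open>H\<close> lying outside the edge-apex class puts \<open>delete_edge H e\<close> outside
    \<open>\<G>\<close>, and \<open>local\<close> applies to it.\<close>
  have "\<exists>P \<subseteq> verts H. card P \<le> c \<and> induced (delete_edge H e) P \<notin> \<G>" if "e \<in> E" for e
    using local[of "delete_edge H e"] sH H_notin that simple_graph_delete_edge[OF sH]
    by (auto simp: edge_apex_def E_def)
  then obtain P where P: "\<And>e. e \<in> E \<Longrightarrow> P e \<subseteq> verts H" "\<And>e. e \<in> E \<Longrightarrow> card (P e) \<le> c"
    "\<And>e. e \<in> E \<Longrightarrow> induced (delete_edge H e) (P e) \<notin> \<G>"
    by metis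
  define T where "T = S \<union> (\<Union>e\<in>E. P e)"
  have T: "T \<subseteq> verts H" "S \<subseteq> T"
    using S(1) P(1) by (auto simp: T_def)
  \<comment> \<open>Contrapositive of heredity: an induced subgraph outside \<open>\<G>\<close>
    certifies that the whole graph is outside.\<close>
  have witness: "G \<notin> \<G>" if "X \<subseteq> verts G" "induced G X \<notin> \<G>" for G X
    using hereditary_induced[OF her] that by blast
  have "induced H T \<notin> \<G>"
    using witness[of S "induced H T"] T(2) S(3) by (simp add: induced_induced)
  moreover have "delete_edge (induced H T) e \<notin> \<G>" if e: "e \<in> edges (induced H T)" for e
  proof (cases "e \<in> E")
    case True
    then have "P e \<subseteq> T"
      by (auto simp: T_def)
    \<comment> \<open>Restriction commutes with edge deletion, so \<open>P e\<close> induces the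
      same graph in \<open>delete_edge (induced H T) e\<close> as in
      \<open>delete_edge H e\<close>.\<close>
    then show ?thesis
      using witness[of "P e" "delete_edge (induced H T) e"] P(3)[OF True]
      by (simp add: induced_delete_edge induced_induced)
  next
    case False
    then have "delete_edge (induced H S) e = induced H S"
      by (simp add: delete_non_edge E_def)
    then show ?thesis
      using witness[of S "delete_edge (induced H T) e"] S(3) T(2)
      by (simp add: induced_delete_edge induced_induced)
  qed
  ultimately have "induced H T \<notin> edge_apex \<G>"
    by (auto simp: edge_apex_def)
  with H_min T(1) have T_eq: "T = verts H"
    by blast
  have finS: "finite S"
    using S(1) sH finite_subset by (auto simp: simple_graph_def)
  have E_Pow: "E \<subseteq> Pow S"
    by (auto simp: E_def)
  then have finE: "finite E"
    using finS by (simp add: finite_subset)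
  have "card E \<le> card (Pow S)"
    using E_Pow finS by (simp add: card_mono)
  also have "\<dots> \<le> 2 ^ c"
    using S(2) finS by (simp add: card_Pow)
  finally have "card E \<le> 2 ^ c" .
  have "card (\<Union>e\<in>E. P e) \<le> (\<Sum>e\<in>E. card (P e))"
    using finE by (rule card_UN_le)
  also have "\<dots> \<le> card E * c"
    using sum_bounded_above[of E "\<lambda>e. card (P e)" c] P(2) by simp
  also have "\<dots> \<le> 2 ^ c * c"
    using \<open>card E \<le> 2 ^ c\<close> by simp
  finally have "card (\<Union>e\<in>E. P e) \<le> 2 ^ c * c" .
  moreover have "card T \<le> card S + card (\<Union>e\<in>E. P e)"
    unfolding T_def by (rule card_Un_le)
  ultimately show ?thesis
    using S(2) T_eq by simp
qed

theorem theorem1p2: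
  fixes \<G> :: "'a graph set"
  assumes "hereditary \<G>"
    and "finite_up_to_iso (forbidden_induced_subgraphs \<G>)"
  shows "hereditary (edge_apex \<G>) \<and>
    finite_up_to_iso (forbidden_induced_subgraphs (edge_apex \<G>))"
proof
  show "hereditary (edge_apex \<G>)"
    using assms(1) by (rule hereditary_edge_apex)
  obtain c where "\<And>H. H \<in> forbidden_induced_subgraphs \<G> \<Longrightarrow> card (verts H) \<le> c"
    using finite_up_to_iso_imp_bounded[OF assms(2)] by metis
  then show "finite_up_to_iso (forbidden_induced_subgraphs (edge_apex \<G>))"
    using card_forbidden_edge_apex_le[OF assms(1)]
    by (intro bounded_imp_finite_up_to_iso[of _ "c + 2 ^ c * c"])
      (auto simp: forbidden_induced_subgraphs_def)
qed

end
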